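(* Let $K:\mathbb{R}\to\mathbb{R}$ be globally Lipschitz continuous with constant $\kappa>0$, i.e. $|K(x)-K(y)|\le \kappa|x-y|$ for all $x,y\in\mathbb{R}$, and assume also $|K(x-y)|\le\kappa|x-y|$ for all $x,y\in\mathbb{R}$. Let $(B_t)_{t\ge 0}$ be a standard one-dimensional Brownian motion and let $\Phi=(x_0,v_0)$ be any two-dimensional random vector independent of $(B_t)_{t\ge0}$ such that $\mathbb{E}[|\Phi|^2]<M<\infty$ for some constant $M$. For each $\beta>0$ let $(x_t^\beta,v_t^\beta)_{t\ge0}$ be the solution of $$dx_t^\beta=v_t^\beta\,dt,\qquad dv_t^\beta=-\beta v_t^\beta\,dt+\beta K\big(x_t^\beta-\mu_t^\beta\big)\,dt+\beta\,dB_t,\qquad \mu_t^\beta=\mathbb{E}[x_t^\beta],$$ with initial state $(x_0^\beta,v_0^\beta)=(x_0,v_0)$, and let $(y_t)_{t\ge0}$ be the solution, driven by the same Brownian motion, of $$dy_t=K\big(y_t-\mathbb{E}[y_t]\big)\,dt+dB_t,\qquad y_0=x_0.$$ Then for every $T<\infty$, $$\mathbb{E}\Big[\sup_{0\le t\le T}\big|x_t^\beta-y_t\big|^2\Big]\to 0\quad\text{as }\beta\to\infty.$$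
   Context: All random objects are defined on a common probability space. All processes $x^\beta,v^\beta,y$ are real-valued. The stochastic differential equations are understood in the Itô sense, i.e. as the corresponding integral equations holding almost surely for all $t\ge0$. "The solution" means the pathwise unique solution with continuous sample paths, adapted to the filtration generated by $\Phi$ and the Brownian motion, and satisfying the moment estimates $\mathbb{E}[\sup_{0\le t\le T}(|x_t^\beta|^2+|v_t^\beta|^2)]<\infty$ (with a bound that may depend on $\beta$ and $T$) and $\mathbb{E}[\sup_{0\le t\le T}|y_t|^2]<\infty$ for every $T<\infty$. Under the stated hypotheses such solutions exist and are pathwise unique (a standard fact). $|\Phi|$ denotes the Euclidean norm. *)

theory Defs
  imports "HOL-Probability.Probability"
begin

definition brownian_motion :: "'a measure \<Rightarrow> (real \<Rightarrow> 'a \<Rightarrow> real) \<Rightarrow> bool" where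
  "brownian_motion P B \<longleftrightarrow>
     (\<forall>t\<ge>0. B t \<in> borel_measurable P) \<and>
     (AE \<omega> in P. B 0 \<omega> = 0) \<and>
     (AE \<omega> in P. continuous_on {0..} (\<lambda>t. B t \<omega>)) \<and>
     (\<forall>s t. 0 \<le> s \<and> s < t \<longrightarrow>
        distributed P lborel (\<lambda>\<omega>. B t \<omega> - B s \<omega>) (normal_density 0 (sqrt (t - s)))) \<and>
     (\<forall>(n::nat) \<tau>. 0 \<le> \<tau> 0 \<and> (\<forall>i<n. \<tau> i < \<tau> (Suc i)) \<longrightarrow>
        prob_space.indep_vars P (\<lambda>_. borel) (\<lambda>i \<omega>. B (\<tau> (Suc i)) \<omega> - B (\<tau> i) \<omega>) {..<n})"

text \<open>Independence of a random vector and a whole process, expressed through the generated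
  \<open>\<sigma>\<close>-algebras because \<^const>\<open>prob_space.indep_var\<close> requires both variables to have the
  same value type.\<close>

definition indep_of_process ::
    "'a measure \<Rightarrow> ('a \<Rightarrow> real \<times> real) \<Rightarrow> (real \<Rightarrow> 'a \<Rightarrow> real) \<Rightarrow> bool" where
  "indep_of_process P \<Phi> B \<longleftrightarrow>
     prob_space.indep_set P
       (sets (vimage_algebra (space P) \<Phi> borel))
       (sets (vimage_algebra (space P) (\<lambda>\<omega>. \<lambda>t\<in>{0..}. B t \<omega>) (PiM {0..} (\<lambda>_. borel))))"

text \<open>The filtration is augmented by the null sets of \<open>P\<close>, since the paths of \<open>B\<close> are only
  almost surely continuous and the equations only hold almost surely. Being adapted to the
  filtration without the null sets implies being adapted to this one.\<close>

definition noise_filtration ::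
    "'a measure \<Rightarrow> ('a \<Rightarrow> real \<times> real) \<Rightarrow> (real \<Rightarrow> 'a \<Rightarrow> real) \<Rightarrow> real \<Rightarrow> 'a measure" where
  "noise_filtration P \<Phi> B t = sigma (space P)
     ({\<Phi> -` A \<inter> space P | A. A \<in> sets borel}
      \<union> (\<Union>s\<in>{0..t}. {B s -` A \<inter> space P | A. A \<in> sets borel})
      \<union> null_sets P)"

definition continuous_adapted ::
    "'a measure \<Rightarrow> ('a \<Rightarrow> real \<times> real) \<Rightarrow> (real \<Rightarrow> 'a \<Rightarrow> real) \<Rightarrow> (real \<Rightarrow> 'a \<Rightarrow> real) \<Rightarrow> bool" where
  "continuous_adapted P \<Phi> B X \<longleftrightarrow>
     (\<forall>t\<ge>0. X t \<in> borel_measurable (noise_filtration P \<Phi> B t)) \<and>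
     (AE \<omega> in P. continuous_on {0..} (\<lambda>t. X t \<omega>))"

text \<open>The noise coefficients are constant, so the stochastic integrals
  \<open>\<integral>\<^sub>0\<^sup>t \<beta> dB\<close> and \<open>\<integral>\<^sub>0\<^sup>t dB\<close> are \<open>\<beta> * B t\<close> and \<open>B t\<close>. In both definitions
  the initial state is \<open>\<Phi> = (x\<^sub>0, v\<^sub>0)\<close>.\<close>

definition second_order_solution ::
    "'a measure \<Rightarrow> (real \<Rightarrow> real) \<Rightarrow> (real \<Rightarrow> 'a \<Rightarrow> real) \<Rightarrow> ('a \<Rightarrow> real \<times> real) \<Rightarrow> real \<Rightarrow>
     (real \<Rightarrow> 'a \<Rightarrow> real) \<Rightarrow> (real \<Rightarrow> 'a \<Rightarrow> real) \<Rightarrow> bool" where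
  "second_order_solution P K B \<Phi> \<beta> x v \<longleftrightarrow>
     continuous_adapted P \<Phi> B x \<and> continuous_adapted P \<Phi> B v \<and>
     (\<forall>T. (\<integral>\<^sup>+\<omega>. (SUP t\<in>{0..T}. ennreal (\<bar>x t \<omega>\<bar>\<^sup>2 + \<bar>v t \<omega>\<bar>\<^sup>2)) \<partial>P) < \<infinity>) \<and>
     (AE \<omega> in P. \<forall>t\<ge>0.
        x t \<omega> = fst (\<Phi> \<omega>) + integral {0..t} (\<lambda>s. v s \<omega>) \<and>
        v t \<omega> = snd (\<Phi> \<omega>)
          + integral {0..t} (\<lambda>s. - \<beta> * v s \<omega> + \<beta> * K (x s \<omega> - (\<integral>\<omega>'. x s \<omega>' \<partial>P)))
          + \<beta> * B t \<omega>)"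

definition first_order_solution ::
    "'a measure \<Rightarrow> (real \<Rightarrow> real) \<Rightarrow> (real \<Rightarrow> 'a \<Rightarrow> real) \<Rightarrow> ('a \<Rightarrow> real \<times> real) \<Rightarrow>
     (real \<Rightarrow> 'a \<Rightarrow> real) \<Rightarrow> bool" where
  "first_order_solution P K B \<Phi> y \<longleftrightarrow>
     continuous_adapted P \<Phi> B y \<and>
     (\<forall>T. (\<integral>\<^sup>+\<omega>. (SUP t\<in>{0..T}. ennreal (\<bar>y t \<omega>\<bar>\<^sup>2)) \<partial>P) < \<infinity>) \<and>
     (AE \<omega> in P. \<forall>t\<ge>0.
        y t \<omega> = fst (\<Phi> \<omega>)
          + integral {0..t} (\<lambda>s. K (y s \<omega> - (\<integral>\<omega>'. y s \<omega>' \<partial>P)))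
          + B t \<omega>)"

end

theory Submission
  imports Defs
begin

text \<open>Put \<open>w = v / \<beta>\<close>. The velocity equation reads \<open>w t + \<beta> * (\<integral>\<^sub>0\<^sup>t w) = f t\<close> with
\<open>f t = v\<^sub>0 / \<beta> + (\<integral>\<^sub>0\<^sup>t K (x - \<mu>)) + B t\<close>, and since \<open>\<beta> * (\<integral>\<^sub>0\<^sup>t w) = x t - x\<^sub>0\<close> the position satisfies
the first-order equation up to the error \<open>v\<^sub>0 / \<beta> - w t\<close>. So two things are needed: \<open>w\<close> is small, and
the small error is not amplified by the mean-field drift.

The function \<open>w\<close> forgets the past of \<open>f\<close> at rate \<open>\<beta>\<close>, so it is bounded by
\<open>\<bar>f 0\<bar>\<close> plus the oscillation of \<open>f\<close> on time scales of order \<open>1 / \<beta>\<close> (lemma \<open>relaxation_bound\<close>).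
For the noise, this oscillation is governed by the modulus of continuity \<open>W n\<close> of the path of \<open>B\<close>
at distance \<open>1 / (n + 1)\<close>, which tends to \<open>0\<close> in mean square by dominated convergence
(\<open>modulus_of_continuity_L2\<close>). A square-integrable bound on \<open>\<bar>B\<bar>\<close>, required there, follows from the
first-order equation and the moment estimate for \<open>y\<close> (\<open>noise_path_bound\<close>).

Amplification is controlled by measuring the distance with an exponential weight: let \<open>Z\<close> be the
supremum of \<open>e\<^bsup>-\<rho>t\<^esup> * \<bar>x t - y t\<bar>\<close> over \<open>{0..T}\<close>. Integrating \<open>e\<^bsup>\<rho>s\<^esup>\<close> gains a factor \<open>1 / \<rho>\<close>, so
the Lipschitz drift, including the distance of the two means, contributes at most
\<open>(\<kappa> / \<rho> + \<kappa> / \<beta>) * (Z + E Z)\<close> (\<open>coupling_pathwise\<close>). For \<open>\<rho> = 8 * \<kappa>\<close> and \<open>\<beta> \<ge> 8 * \<kappa>\<close> this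
is at most \<open>(Z + E Z) / 4\<close>. Since \<open>Z\<close> is square integrable it can be absorbed on the left,
first in expectation and then pathwise (\<open>second_moment_self_bound\<close>), and the second moment of
\<open>Z\<close> is at most five times that of the remainder
\<open>W n + (2 * \<bar>v\<^sub>0\<bar> + 2 * (n + 1) * S + \<kappa> * (Y + E Y)) / \<beta>\<close>, where \<open>S\<close> and \<open>Y\<close> dominate \<open>\<bar>B\<bar>\<close> and
\<open>\<bar>y\<bar>\<close>. Choosing \<open>n\<close> large and then letting \<open>\<beta>\<close> tend to infinity gives the claim.\<close>

section \<open>Pathwise estimates\<close>

text \<open>The equation says that \<open>w\<close> is what remains of \<open>f\<close> after exponential relaxation at rate \<open>\<beta>\<close>. An
oscillation \<open>a\<close> of \<open>f\<close> survives, but a linear growth at rate \<open>c\<close> lasts only for a time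
\<open>1 / \<beta>\<close>. Allowing both lets one estimate serve the rough noise and the Lipschitz drift.\<close>

lemma relaxation_bound:
  fixes w f :: "real \<Rightarrow> real"
  assumes \<beta>: "0 < \<beta>" and t: "0 \<le> t" and c: "0 \<le> c" and w: "continuous_on {0..t} w"
    and eq: "\<And>s. s \<in> {0..t} \<Longrightarrow> w s + \<beta> * integral {0..s} w = f s"
    and f: "\<And>s. s \<in> {0..t} \<Longrightarrow> \<bar>f t - f s\<bar> \<le> a + c * (t - s)"
  shows "\<bar>w t\<bar> \<le> \<bar>f 0\<bar> + a + c / \<beta>"
proof (cases "t = 0")
  case True
  then have "\<bar>w t\<bar> = \<bar>f 0\<bar>" using eq[of 0] by simp
  moreover have "0 \<le> a" using f[of 0] True by simp
  ultimately show ?thesis using \<beta> c by simp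
next
  case False
  with t have t: "0 < t" by simp
  define J where "J s = integral {0..s} w" for s
  \<comment> \<open>\<open>g\<close> is the integrated velocity relative to its instantaneous equilibrium \<open>f t / \<beta>\<close>, with the
    exponential relaxation factored out; \<open>h\<close> is an antiderivative of the resulting bound on \<open>\<bar>g'\<bar>\<close>.\<close>
  define g where "g s = exp (\<beta> * s) * (J s - f t / \<beta>)" for s
  define h where "h s = exp (\<beta> * s) * (a / \<beta> + c * (t - s) / \<beta> + c / \<beta>\<^sup>2)" for s
  have J': "(J has_real_derivative w s) (at s within {0..t})" if "s \<in> {0..t}" for s
    using integral_has_vector_derivative[OF w that] unfolding J_def
    by (simp add: has_real_derivative_iff_has_vector_derivative)
  have g': "(g has_real_derivative exp (\<beta> * s) * (f s - f t)) (at s within {0..t})" if "s \<in> {0..t}" for s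
    unfolding g_def eq[OF that, folded J_def, symmetric] using \<beta>
    by (auto intro!: derivative_eq_intros J'[OF that] simp: field_simps)
  have h': "(h has_real_derivative exp (\<beta> * s) * (a + c * (t - s))) (at s within {0..t})" for s
    unfolding h_def using \<beta>
    by (auto intro!: derivative_eq_intros simp: field_simps power2_eq_square)
  have "norm (g t - g 0) \<le> h t - h 0"
  proof (rule differentiable_bound_general[OF t, where f' = "\<lambda>s. exp (\<beta> * s) * (f s - f t)"
        and \<phi>' = "\<lambda>s. exp (\<beta> * s) * (a + c * (t - s))"])
    show "continuous_on {0..t} g" using g' by (intro DERIV_continuous_on)
    show "continuous_on {0..t} h" using h' by (intro DERIV_continuous_on)
    fix s assume s: "0 < s" "s < t"
    then have at: "at s within {0..t} = at s" by (intro at_within_interior) (simp add: interior_atLeastAtMost_real)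
    show "(g has_vector_derivative exp (\<beta> * s) * (f s - f t)) (at s)"
      using g'[of s] s at by (simp add: has_real_derivative_iff_has_vector_derivative)
    show "(h has_vector_derivative exp (\<beta> * s) * (a + c * (t - s))) (at s)"
      using h'[of s] at by (simp add: has_real_derivative_iff_has_vector_derivative)
    show "norm (exp (\<beta> * s) * (f s - f t)) \<le> exp (\<beta> * s) * (a + c * (t - s))"
      using f[of s] s by (auto simp: abs_mult abs_minus_commute)
  qed
  moreover have "J 0 = 0" by (simp add: J_def)
  moreover have "J t - f t / \<beta> = - w t / \<beta>"
    using eq[of t, folded J_def, symmetric] t \<beta> by (simp add: field_simps)
  ultimately have "\<bar>f t / \<beta> - exp (\<beta> * t) * w t / \<beta>\<bar> \<le>
      exp (\<beta> * t) * (a / \<beta> + c / \<beta>\<^sup>2) - (a / \<beta> + c * t / \<beta> + c / \<beta>\<^sup>2)"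
    by (simp add: g_def h_def algebra_simps)
  moreover have "\<bar>f t / \<beta>\<bar> \<le> (\<bar>f 0\<bar> + (a + c * t)) / \<beta>"
    using f[of 0] t \<beta> by (simp add: divide_right_mono)
  moreover have "\<bar>exp (\<beta> * t) * w t / \<beta>\<bar> = exp (\<beta> * t) * \<bar>w t\<bar> / \<beta>"
    using \<beta> by (simp add: abs_mult)
  ultimately have "exp (\<beta> * t) * \<bar>w t\<bar> / \<beta> \<le> (\<bar>f 0\<bar> + (a + c * t)) / \<beta> +
      (exp (\<beta> * t) * (a / \<beta> + c / \<beta>\<^sup>2) - (a / \<beta> + c * t / \<beta> + c / \<beta>\<^sup>2))"
    by linarith
  also have "\<dots> \<le> \<bar>f 0\<bar> / \<beta> + exp (\<beta> * t) * (a / \<beta> + c / \<beta>\<^sup>2)"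
    using c \<beta> by (simp add: add_divide_distrib)
  also have "\<bar>f 0\<bar> / \<beta> \<le> exp (\<beta> * t) * (\<bar>f 0\<bar> / \<beta>)"
    using \<beta> t mult_right_mono[of 1 "exp (\<beta> * t)" "\<bar>f 0\<bar> / \<beta>"] by simp
  finally have "exp (\<beta> * t) * (\<bar>w t\<bar> / \<beta>) \<le> exp (\<beta> * t) * ((\<bar>f 0\<bar> + a + c / \<beta>) / \<beta>)"
    by (simp add: algebra_simps add_divide_distrib power2_eq_square)
  then show ?thesis using \<beta> by (simp add: divide_le_cancel)
qed

text \<open>This is the factor \<open>1 / \<rho>\<close> that an integral in time gains when functions are measured against the
weight \<open>exp (\<rho> * s)\<close>.\<close>

lemma abs_integral_exp_le:
  fixes g :: "real \<Rightarrow> real"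
  assumes \<rho>: "0 < \<rho>" and t: "0 \<le> t" and C: "0 \<le> C" and g: "g integrable_on {0..t}"
    and bound: "\<And>s. s \<in> {0..t} \<Longrightarrow> \<bar>g s\<bar> \<le> C * exp (\<rho> * s)"
  shows "\<bar>integral {0..t} g\<bar> \<le> C * exp (\<rho> * t) / \<rho>"
proof -
  have I: "((\<lambda>s. C * exp (\<rho> * s)) has_integral C * exp (\<rho> * t) / \<rho> - C * exp (\<rho> * 0) / \<rho>) {0..t}"
    using \<rho> t by (intro fundamental_theorem_of_calculus)
      (auto intro!: derivative_eq_intros simp flip: has_real_derivative_iff_has_vector_derivative)
  have "norm (integral {0..t} g) \<le> integral {0..t} (\<lambda>s. C * exp (\<rho> * s))"
    using g I bound by (intro integral_norm_bound_integral) (auto simp: integrable_on_def)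
  also have "\<dots> = C * exp (\<rho> * t) / \<rho> - C / \<rho>"
    using integral_unique[OF I] by simp
  also have "\<dots> \<le> C * exp (\<rho> * t) / \<rho>" using C \<rho> by simp
  finally show ?thesis by simp
qed

text \<open>The functions \<open>x\<close>, \<open>v\<close>, \<open>y\<close>, \<open>b\<close> stand for single paths and \<open>\<mu>\<close>, \<open>\<nu>\<close> for the means of the two
positions. The weighted distances \<open>S\<close> and \<open>A\<close> of paths and means reappear on the right with a
factor that is small for large \<open>\<rho>\<close> and \<open>\<beta>\<close>: \<open>\<kappa> / \<rho>\<close> comes from the drift difference in the
positions, \<open>\<kappa> / \<beta>\<close> from the drift in the relaxing velocity. The feedback
through the drift is thus closed by absorbing these terms on the left.\<close>

lemma coupling_pathwise:
  fixes x v y b \<mu> \<nu> K :: "real \<Rightarrow> real"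
  assumes pos: "0 < \<kappa>" "0 < \<rho>" "0 < \<beta>"
    and K: "\<kappa>-lipschitz_on UNIV K" "\<And>z. \<bar>K z\<bar> \<le> \<kappa> * \<bar>z\<bar>"
    and cont: "continuous_on {0..T} x" "continuous_on {0..T} v" "continuous_on {0..T} y"
      "continuous_on {0..T} \<mu>" "continuous_on {0..T} \<nu>"
    and b0: "b 0 = 0"
    and x: "\<And>t. t \<in> {0..T} \<Longrightarrow> x t = \<xi> + integral {0..t} v"
    and v: "\<And>t. t \<in> {0..T} \<Longrightarrow>
      v t = \<eta> + integral {0..t} (\<lambda>s. - \<beta> * v s + \<beta> * K (x s - \<mu> s)) + \<beta> * b t"
    and y: "\<And>t. t \<in> {0..T} \<Longrightarrow> y t = \<xi> + integral {0..t} (\<lambda>s. K (y s - \<nu> s)) + b t"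
    and S: "\<And>t. t \<in> {0..T} \<Longrightarrow> \<bar>x t - y t\<bar> \<le> exp (\<rho> * t) * S"
    and A: "\<And>t. t \<in> {0..T} \<Longrightarrow> \<bar>\<mu> t - \<nu> t\<bar> \<le> exp (\<rho> * t) * A"
    and Y: "\<And>t. t \<in> {0..T} \<Longrightarrow> \<bar>y t - \<nu> t\<bar> \<le> Y"
    and W: "\<And>s t. s \<in> {0..T} \<Longrightarrow> t \<in> {0..T} \<Longrightarrow> \<bar>b t - b s\<bar> \<le> W + C * \<bar>t - s\<bar>"
    and C: "0 \<le> C" and t: "t \<in> {0..T}"
  shows "\<bar>x t - y t\<bar> \<le>
    exp (\<rho> * t) * ((\<kappa> / \<rho> + \<kappa> / \<beta>) * (S + A)) + W + (2 * \<bar>\<eta>\<bar> + C + \<kappa> * Y) / \<beta>"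
proof -
  have t0: "0 \<le> t" "{0..t} \<subseteq> {0..T}" using t by auto
  have contK: "continuous_on {0..t} (\<lambda>s. K (f s))" if "continuous_on {0..t} f" for f :: "real \<Rightarrow> real"
    using continuous_on_compose2[OF lipschitz_on_continuous_on[OF K(1)] that] by simp
  note c = cont[THEN continuous_on_subset, OF t0(2)]
  have Kx: "continuous_on {0..t} (\<lambda>s. K (x s - \<mu> s))" and Ky: "continuous_on {0..t} (\<lambda>s. K (y s - \<nu> s))"
    by (intro contK continuous_intros c)+
  \<comment> \<open>The force on the second-order particle at time \<open>s \<le> t\<close> is compared with that on the
    first-order one, whose distance from its mean is at most \<open>Y\<close>.\<close>
  define D where "D = exp (\<rho> * t) * (S + A) + Y"
  have drift: "\<bar>K (x s - \<mu> s)\<bar> \<le> \<kappa> * D" if s: "s \<in> {0..t}" for s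
  proof -
    have "\<bar>x s - \<mu> s\<bar> \<le> exp (\<rho> * s) * (S + A) + Y"
      using S[of s] A[of s] Y[of s] s t by (auto simp: algebra_simps)
    moreover have "exp (\<rho> * s) * (S + A) \<le> exp (\<rho> * t) * (S + A)"
    proof (rule mult_right_mono)
      have "0 \<le> exp (\<rho> * s) * (S + A)"
        using S[of s] A[of s] s t by (auto simp: algebra_simps)
      then show "0 \<le> S + A" by (simp add: zero_le_mult_iff)
    qed (use s pos in auto)
    ultimately show ?thesis
      using K(2)[of "x s - \<mu> s"] pos(1) unfolding D_def
      by (smt (verit) mult_left_mono)
  qed
  have D0: "0 \<le> \<kappa> * D" using drift[of t] t0 by force
  \<comment> \<open>The rescaled velocity \<open>w\<close> relaxes towards the integrated forcing \<open>f\<close>, and it is all that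
    separates the position equation from the first-order one: \<open>x t = \<xi> + f t - w t\<close>.\<close>
  define w where "w s = v s / \<beta>" for s
  define f where "f s = \<eta> / \<beta> + integral {0..s} (\<lambda>r. K (x r - \<mu> r)) + b s" for s
  have weq: "w s + \<beta> * integral {0..s} w = f s" if s: "s \<in> {0..t}" for s
  proof -
    have sub: "{0..s} \<subseteq> {0..t}" using s by auto
    have "v s = \<eta> + (- \<beta> * integral {0..s} v + \<beta> * integral {0..s} (\<lambda>r. K (x r - \<mu> r))) + \<beta> * b s"
      unfolding v[of s, OF subsetD[OF t0(2) s]]
      using continuous_on_subset[OF c(2) sub] continuous_on_subset[OF Kx sub]
      by (subst Henstock_Kurzweil_Integration.integral_add)
        (auto intro!: integrable_continuous_real continuous_intros)
    moreover have "integral {0..s} w = integral {0..s} v / \<beta>"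
      unfolding w_def by simp
    ultimately show ?thesis using pos(3) by (simp add: w_def f_def field_simps)
  qed
  have "\<bar>w t\<bar> \<le> \<bar>f 0\<bar> + W + (C + \<kappa> * D) / \<beta>"
  proof (rule relaxation_bound[OF pos(3) t0(1) _ _ weq])
    show "continuous_on {0..t} w" unfolding w_def using pos by (intro continuous_intros c) auto
    show "0 \<le> C + \<kappa> * D" using C D0 by simp
    fix s assume s: "s \<in> {0..t}"
    have "integral {0..s} (\<lambda>r. K (x r - \<mu> r)) + integral {s..t} (\<lambda>r. K (x r - \<mu> r)) =
        integral {0..t} (\<lambda>r. K (x r - \<mu> r))"
      using s by (intro Henstock_Kurzweil_Integration.integral_combine integrable_continuous_real Kx) auto
    moreover have "norm (integral {s..t} (\<lambda>r. K (x r - \<mu> r))) \<le> \<kappa> * D * (t - s)"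
      using s by (intro integral_bound continuous_on_subset[OF Kx]) (auto intro: drift)
    moreover have "\<bar>b t - b s\<bar> \<le> W + C * (t - s)"
      using W[of s t] s t by auto
    ultimately show "\<bar>f t - f s\<bar> \<le> W + (C + \<kappa> * D) * (t - s)"
      unfolding f_def by (simp add: algebra_simps)
  qed
  moreover have abs_eta: "\<bar>\<eta> / \<beta>\<bar> = \<bar>\<eta>\<bar> / \<beta>" using pos by simp
  moreover have "f 0 = \<eta> / \<beta>" using b0 by (simp add: f_def)
  moreover have "\<bar>integral {0..t} (\<lambda>s. K (x s - \<mu> s) - K (y s - \<nu> s))\<bar>
      \<le> (\<kappa> * (S + A)) * exp (\<rho> * t) / \<rho>"
  proof (rule abs_integral_exp_le[OF pos(2) t0(1)])
    show "(\<lambda>s. K (x s - \<mu> s) - K (y s - \<nu> s)) integrable_on {0..t}"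
      by (intro integrable_continuous_real continuous_intros Kx Ky)
    show "0 \<le> \<kappa> * (S + A)"
      using S[of 0] A[of 0] t pos by (intro mult_nonneg_nonneg) auto
    fix s assume s: "s \<in> {0..t}"
    have "\<bar>K (x s - \<mu> s) - K (y s - \<nu> s)\<bar> \<le> \<kappa> * \<bar>(x s - \<mu> s) - (y s - \<nu> s)\<bar>"
      using lipschitz_onD[OF K(1), of "x s - \<mu> s" "y s - \<nu> s"] by (simp add: dist_real_def)
    also have "\<dots> \<le> \<kappa> * (exp (\<rho> * s) * S + exp (\<rho> * s) * A)"
      using S[of s] A[of s] s t pos by (intro mult_left_mono) auto
    finally show "\<bar>K (x s - \<mu> s) - K (y s - \<nu> s)\<bar> \<le> \<kappa> * (S + A) * exp (\<rho> * s)"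
      by (simp add: algebra_simps)
  qed
  moreover have "integral {0..t} (\<lambda>s. K (x s - \<mu> s) - K (y s - \<nu> s)) =
      integral {0..t} (\<lambda>s. K (x s - \<mu> s)) - integral {0..t} (\<lambda>s. K (y s - \<nu> s))"
    by (intro Henstock_Kurzweil_Integration.integral_diff integrable_continuous_real Kx Ky)
  moreover have "x t = \<xi> + (f t - w t)"
  proof -
    have "integral {0..t} w = integral {0..t} v / \<beta>" unfolding w_def by simp
    then show ?thesis using x[OF t] weq[of t] t pos by (auto simp: field_simps)
  qed
  ultimately have "\<bar>x t - y t\<bar> \<le> (\<kappa> * (S + A)) * exp (\<rho> * t) / \<rho> + \<bar>\<eta>\<bar> / \<beta>
      + (\<bar>\<eta>\<bar> / \<beta> + W + (C + \<kappa> * D) / \<beta>)"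
    using y[OF t] f_def[of t] abs_eta by (smt (verit))
  also have "\<dots> = exp (\<rho> * t) * ((\<kappa> / \<rho> + \<kappa> / \<beta>) * (S + A)) + W + (2 * \<bar>\<eta>\<bar> + C + \<kappa> * Y) / \<beta>"
    using pos unfolding D_def by (simp add: field_simps)
  finally show ?thesis .
qed

text \<open>Solving the equation for the noise turns a bound on the solution and its mean into a bound on the
driving path; the supremum of \<open>\<bar>b\<bar>\<close> thereby inherits its moments from the solution.\<close>

lemma noise_path_bound:
  fixes y b :: "real \<Rightarrow> real" and K :: "real \<Rightarrow> real"
  assumes \<kappa>: "0 < \<kappa>"
    and K: "\<And>z. \<bar>K z\<bar> \<le> \<kappa> * \<bar>z\<bar>" "continuous_on UNIV K"
    and cont: "continuous_on {0..T} y" "continuous_on {0..T} \<nu>"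
    and Y: "\<And>t. t \<in> {0..T} \<Longrightarrow> \<bar>y t\<bar> \<le> Y" "\<And>t. t \<in> {0..T} \<Longrightarrow> \<bar>\<nu> t\<bar> \<le> m"
    and y: "\<And>t. t \<in> {0..T} \<Longrightarrow> y t = \<xi> + integral {0..t} (\<lambda>s. K (y s - \<nu> s)) + b t"
    and t: "t \<in> {0..T}"
  shows "\<bar>b t\<bar> \<le> Y + \<bar>\<xi>\<bar> + \<kappa> * T * (Y + m)"
proof -
  have K_le: "\<bar>K (y s - \<nu> s)\<bar> \<le> \<kappa> * (Y + m)" if "s \<in> {0..t}" for s
  proof -
    have "\<bar>y s - \<nu> s\<bar> \<le> Y + m" using Y[of s] that t by (smt (verit) atLeastAtMost_iff)
    then have "\<kappa> * \<bar>y s - \<nu> s\<bar> \<le> \<kappa> * (Y + m)" using \<kappa> by simp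
    then show ?thesis using K(1)[of "y s - \<nu> s"] by linarith
  qed
  have "norm (integral {0..t} (\<lambda>s. K (y s - \<nu> s))) \<le> \<kappa> * (Y + m) * (t - 0)"
  proof (rule integral_bound)
    show "continuous_on {0..t} (\<lambda>s. K (y s - \<nu> s))"
      using t by (intro continuous_on_compose2[OF K(2)] continuous_intros
          continuous_on_subset[OF cont(1)] continuous_on_subset[OF cont(2)]) auto
  qed (use t K_le in auto)
  also have "\<dots> \<le> \<kappa> * (Y + m) * T"
    using t \<kappa> K_le[of 0] by (intro mult_left_mono) (auto intro: order_trans[OF abs_ge_zero])
  finally have "\<bar>integral {0..t} (\<lambda>s. K (y s - \<nu> s))\<bar> \<le> \<kappa> * T * (Y + m)"
    by (simp add: algebra_simps)
  then show ?thesis using y[OF t] Y(1)[OF t] by linarith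
qed

section \<open>Square-integrable random variables\<close>

definition L2 :: "'a measure \<Rightarrow> ('a \<Rightarrow> real) \<Rightarrow> bool" where
  "L2 M X \<longleftrightarrow> X \<in> borel_measurable M \<and> integrable M (\<lambda>\<omega>. (X \<omega>)\<^sup>2)"

lemma L2_square: "L2 M X \<Longrightarrow> integrable M (\<lambda>\<omega>. (X \<omega>)\<^sup>2)"
  by (simp add: L2_def)

lemma (in finite_measure) L2_integrable: "L2 M X \<Longrightarrow> integrable M X"
  using square_integrable_imp_integrable by (auto simp: L2_def)

lemma L2_bound:
  assumes "L2 M Y" "X \<in> borel_measurable M" "AE \<omega> in M. \<bar>X \<omega>\<bar> \<le> Y \<omega>"
  shows "L2 M X"
proof -
  have "integrable M (\<lambda>\<omega>. (X \<omega>)\<^sup>2)"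
  proof (rule Bochner_Integration.integrable_bound[OF L2_square[OF assms(1)]])
    show "AE \<omega> in M. norm ((X \<omega>)\<^sup>2) \<le> norm ((Y \<omega>)\<^sup>2)"
      using assms(3) by eventually_elim (auto simp: abs_le_square_iff[symmetric])
  qed (use assms in measurable)
  with assms show ?thesis by (simp add: L2_def)
qed

lemma L2_cmult: "L2 M X \<Longrightarrow> L2 M (\<lambda>\<omega>. c * X \<omega>)"
  by (auto simp: L2_def power_mult_distrib)

lemma L2_abs: "L2 M X \<Longrightarrow> L2 M (\<lambda>\<omega>. \<bar>X \<omega>\<bar>)"
  by (auto simp: L2_def)

lemma (in finite_measure) L2_const: "L2 M (\<lambda>\<omega>. c)"
  by (auto simp: L2_def)

lemma sum_squared_le: "(a + b)\<^sup>2 \<le> 2 * a\<^sup>2 + 2 * (b::real)\<^sup>2"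
  using zero_le_power2[of "a - b"] by (simp add: power2_sum power2_diff)

lemma L2_add:
  assumes "L2 M X" "L2 M Y"
  shows "L2 M (\<lambda>\<omega>. X \<omega> + Y \<omega>)"
proof -
  have [measurable]: "X \<in> borel_measurable M" "Y \<in> borel_measurable M"
    using assms by (auto simp: L2_def)
  have "integrable M (\<lambda>\<omega>. 2 * (X \<omega>)\<^sup>2 + 2 * (Y \<omega>)\<^sup>2)"
    using assms by (auto simp: L2_def)
  then have "integrable M (\<lambda>\<omega>. (X \<omega> + Y \<omega>)\<^sup>2)"
    by (rule Bochner_Integration.integrable_bound) (auto simp: sum_squared_le)
  then show ?thesis by (simp add: L2_def)
qed

lemma (in prob_space) abs_expectation_le:
  assumes "L2 M S" "X \<in> borel_measurable M" "AE \<omega> in M. \<bar>X \<omega>\<bar> \<le> S \<omega>"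
  shows "\<bar>expectation X\<bar> \<le> expectation S"
proof -
  have "\<bar>expectation X\<bar> \<le> expectation (\<lambda>\<omega>. \<bar>X \<omega>\<bar>)" by (rule integral_abs_bound)
  also have "\<dots> \<le> expectation S"
    using L2_integrable[OF L2_bound[OF assms]] L2_integrable[OF assms(1)] assms(3)
    by (intro integral_mono_AE) auto
  finally show ?thesis .
qed

text \<open>A McKean--Vlasov distance enters its own estimate together with its mean. The expectation of the
hypothesis bounds the mean by that of \<open>R\<close>; this absorption uses that \<open>Z\<close> is integrable.\<close>

lemma (in prob_space) second_moment_self_bound:
  assumes Z: "L2 M Z" and R: "L2 M R" and Z0: "\<And>\<omega>. 0 \<le> Z \<omega>"
    and le: "AE \<omega> in M. Z \<omega> \<le> (Z \<omega> + expectation Z) / 4 + R \<omega>"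
  shows "expectation (\<lambda>\<omega>. (Z \<omega>)\<^sup>2) \<le> 5 * expectation (\<lambda>\<omega>. (R \<omega>)\<^sup>2)"
proof -
  note int = L2_integrable[OF Z] L2_integrable[OF R]
  have "expectation Z \<le> expectation (\<lambda>\<omega>. (Z \<omega> + expectation Z) / 4 + R \<omega>)"
    using int by (intro integral_mono_AE le) auto
  also have "\<dots> = expectation Z / 2 + expectation R"
    using int by (simp add: prob_space)
  finally have EZ: "expectation Z \<le> 2 * expectation R" by simp
  \<comment> \<open>With the mean bounded, the hypothesis is a pathwise bound on \<open>Z\<close>.\<close>
  have "AE \<omega> in M. (Z \<omega>)\<^sup>2 \<le> (8 * (expectation R)\<^sup>2 + 32 * (R \<omega>)\<^sup>2) / 9"
    using le
  proof eventually_elim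
    case (elim \<omega>)
    have "Z \<omega> \<le> 2 / 3 * expectation R + 4 / 3 * R \<omega>"
      using elim EZ by (simp add: field_simps)
    then have "(Z \<omega>)\<^sup>2 \<le> (2 / 3 * expectation R + 4 / 3 * R \<omega>)\<^sup>2"
      using Z0 by (intro power_mono)
    also have "\<dots> \<le> 2 * (2 / 3 * expectation R)\<^sup>2 + 2 * (4 / 3 * R \<omega>)\<^sup>2"
      by (rule sum_squared_le)
    finally show ?case by (simp add: power_mult_distrib power_divide)
  qed
  then have "expectation (\<lambda>\<omega>. (Z \<omega>)\<^sup>2) \<le> expectation (\<lambda>\<omega>. (8 * (expectation R)\<^sup>2 + 32 * (R \<omega>)\<^sup>2) / 9)"
    using L2_square[OF Z] L2_square[OF R] by (intro integral_mono_AE) auto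
  also have "\<dots> = (8 * (expectation R)\<^sup>2 + 32 * expectation (\<lambda>\<omega>. (R \<omega>)\<^sup>2)) / 9"
    using L2_square[OF R] by (simp add: prob_space)
  also have "\<dots> \<le> 5 * expectation (\<lambda>\<omega>. (R \<omega>)\<^sup>2)"
  proof -
    have "0 \<le> variance R" by simp
    then have "(expectation R)\<^sup>2 \<le> expectation (\<lambda>\<omega>. (R \<omega>)\<^sup>2)"
      using int L2_square[OF R] by (simp add: variance_eq)
    moreover have "0 \<le> expectation (\<lambda>\<omega>. (R \<omega>)\<^sup>2)" by (rule integral_nonneg_AE) simp
    moreover have "(8 * a + 32 * q) / 9 \<le> 5 * q" if "a \<le> q" "0 \<le> q" for a q :: real
      using that by simp
    ultimately show ?thesis by blast
  qed
  finally show ?thesis .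
qed

section \<open>Suprema of continuous processes\<close>

text \<open>The pointwise supremum over an uncountable index set need not be measurable on a space that is not
complete, because the paths are only almost surely continuous; a measurable version is used instead.\<close>

lemma path_sup:
  fixes Z :: "'i::{metric_space,second_countable_topology} \<Rightarrow> 'a \<Rightarrow> real"
  assumes I: "compact I" "I \<noteq> {}"
    and meas: "\<And>i. i \<in> I \<Longrightarrow> Z i \<in> borel_measurable M"
    and cont: "AE \<omega> in M. continuous_on I (\<lambda>i. Z i \<omega>)"
  obtains S where "S \<in> borel_measurable M" "\<And>\<omega>. 0 \<le> S \<omega>"
    "AE \<omega> in M. (\<forall>i\<in>I. \<bar>Z i \<omega>\<bar> \<le> S \<omega>) \<and> (\<exists>i\<in>I. S \<omega> = \<bar>Z i \<omega>\<bar>)"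
proof -
  obtain D where D: "countable D" "D \<subseteq> I" "I \<subseteq> closure D"
    using separable by blast
  \<comment> \<open>The supremum over a countable dense subset is measurable, and by continuity of almost
    every path it is the supremum over \<open>I\<close>, which is a maximum because \<open>I\<close> is compact.\<close>
  define S where "S \<omega> = enn2real (SUP d\<in>D. ennreal \<bar>Z d \<omega>\<bar>)" for \<omega>
  have "S \<in> borel_measurable M"
    unfolding S_def using D meas by (intro measurable_compose[OF borel_measurable_SUP]) auto
  moreover have "0 \<le> S \<omega>" for \<omega> by (simp add: S_def)
  moreover have "AE \<omega> in M. (\<forall>i\<in>I. \<bar>Z i \<omega>\<bar> \<le> S \<omega>) \<and> (\<exists>i\<in>I. S \<omega> = \<bar>Z i \<omega>\<bar>)"
    using cont
  proof eventually_elim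
    case (elim \<omega>)
    then have c: "continuous_on I (\<lambda>i. \<bar>Z i \<omega>\<bar>)" by (intro continuous_intros)
    obtain m where m: "m \<in> I" "\<And>i. i \<in> I \<Longrightarrow> \<bar>Z i \<omega>\<bar> \<le> \<bar>Z m \<omega>\<bar>"
      using continuous_attains_sup[OF I c] by auto
    define s where "s = (SUP d\<in>D. ennreal \<bar>Z d \<omega>\<bar>)"
    have s_le: "s \<le> ennreal \<bar>Z m \<omega>\<bar>"
      unfolding s_def using D m by (intro SUP_least ennreal_leI) auto
    then have fin: "s < \<top>" by (simp add: le_less_trans)
    have D_le: "\<bar>Z d \<omega>\<bar> \<le> S \<omega>" if "d \<in> D" for d
    proof -
      have "ennreal \<bar>Z d \<omega>\<bar> \<le> s" unfolding s_def using that by (rule SUP_upper)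
      then show ?thesis
        using fin unfolding S_def s_def[symmetric]
        by (metis enn2real_ennreal enn2real_mono abs_ge_zero)
    qed
    have "\<bar>Z m \<omega>\<bar> \<le> S \<omega>"
    proof -
      have "m \<in> closure D" using D m by auto
      then obtain d where d: "\<And>n. d n \<in> D" "d \<longlonglongrightarrow> m"
        unfolding closure_sequential by auto
      have "(\<lambda>n. \<bar>Z (d n) \<omega>\<bar>) \<longlonglongrightarrow> \<bar>Z m \<omega>\<bar>"
        using c d m(1) D(2) unfolding continuous_on_sequentially by (auto simp: o_def)
      then show ?thesis
        by (rule LIMSEQ_le_const2) (use d D_le in auto)
    qed
    moreover have "S \<omega> \<le> \<bar>Z m \<omega>\<bar>"
      using s_le unfolding S_def s_def[symmetric]
      by (metis enn2real_ennreal enn2real_mono abs_ge_zero ennreal_less_top)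
    ultimately show ?case using m by force
  qed
  ultimately show thesis using that by blast
qed

lemma second_moment_path_sup:
  fixes X :: "real \<Rightarrow> 'a \<Rightarrow> real"
  assumes T: "0 \<le> T" and meas: "\<And>t. t \<in> {0..T} \<Longrightarrow> X t \<in> borel_measurable M"
    and cont: "AE \<omega> in M. continuous_on {0..T} (\<lambda>t. X t \<omega>)"
    and fin: "(\<integral>\<^sup>+\<omega>. (SUP t\<in>{0..T}. ennreal (\<bar>X t \<omega>\<bar>\<^sup>2)) \<partial>M) < \<infinity>"
  obtains S where "L2 M S" "AE \<omega> in M. \<forall>t\<in>{0..T}. \<bar>X t \<omega>\<bar> \<le> S \<omega>"
proof -
  obtain S where S: "S \<in> borel_measurable M" "\<And>\<omega>. 0 \<le> S \<omega>"
    "AE \<omega> in M. (\<forall>t\<in>{0..T}. \<bar>X t \<omega>\<bar> \<le> S \<omega>) \<and> (\<exists>t\<in>{0..T}. S \<omega> = \<bar>X t \<omega>\<bar>)"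
    using path_sup[of "{0..T}" X M] T meas cont by auto
  have "(\<integral>\<^sup>+\<omega>. ennreal (norm ((S \<omega>)\<^sup>2)) \<partial>M) \<le> (\<integral>\<^sup>+\<omega>. (SUP t\<in>{0..T}. ennreal (\<bar>X t \<omega>\<bar>\<^sup>2)) \<partial>M)"
    using S(3) by (intro nn_integral_mono_AE, eventually_elim) (auto intro!: SUP_upper2)
  then have "integrable M (\<lambda>\<omega>. (S \<omega>)\<^sup>2)"
    using fin S(1) by (intro integrableI_bounded) auto
  then show thesis
    using S by (intro that[of S]) (auto simp: L2_def elim!: eventually_mono)
qed

lemma continuous_on_expectation:
  fixes X :: "'t::metric_space \<Rightarrow> 'a \<Rightarrow> real"
  assumes meas: "\<And>t. t \<in> I \<Longrightarrow> X t \<in> borel_measurable M"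
    and cont: "AE \<omega> in M. continuous_on I (\<lambda>t. X t \<omega>)"
    and S: "integrable M S" "AE \<omega> in M. \<forall>t\<in>I. \<bar>X t \<omega>\<bar> \<le> S \<omega>"
  shows "continuous_on I (\<lambda>t. \<integral>\<omega>. X t \<omega> \<partial>M)"
  unfolding continuous_on_sequentially o_def
proof (intro ballI allI impI, elim conjE)
  fix u a assume a: "a \<in> I" and u: "\<forall>n. u n \<in> I" "u \<longlonglongrightarrow> a"
  show "(\<lambda>n. \<integral>\<omega>. X (u n) \<omega> \<partial>M) \<longlonglongrightarrow> (\<integral>\<omega>. X a \<omega> \<partial>M)"
  proof (rule integral_dominated_convergence[where w = S])
    show "AE \<omega> in M. (\<lambda>n. X (u n) \<omega>) \<longlonglongrightarrow> X a \<omega>"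
      using cont by eventually_elim (use a u in \<open>auto simp: continuous_on_sequentially o_def\<close>)
    show "AE \<omega> in M. norm (X (u n) \<omega>) \<le> S \<omega>" for n
      using S(2) by eventually_elim (use u in auto)
  qed (use meas a u S in auto)
qed

text \<open>The increments are bounded by a small random constant plus a linear term with a large constant, the
form in which \<open>relaxation_bound\<close> consumes them.\<close>

lemma modulus_of_continuity_L2:
  fixes b :: "real \<Rightarrow> 'a \<Rightarrow> real"
  assumes T: "0 \<le> T" and meas: "\<And>t. t \<in> {0..T} \<Longrightarrow> b t \<in> borel_measurable M"
    and cont: "AE \<omega> in M. continuous_on {0..T} (\<lambda>t. b t \<omega>)"
    and S: "L2 M S" "AE \<omega> in M. \<forall>t\<in>{0..T}. \<bar>b t \<omega>\<bar> \<le> S \<omega>"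
  obtains W :: "nat \<Rightarrow> 'a \<Rightarrow> real" where "\<And>n. L2 M (W n)"
    "(\<lambda>n. \<integral>\<omega>. (W n \<omega>)\<^sup>2 \<partial>M) \<longlonglongrightarrow> 0"
    "\<And>n. AE \<omega> in M. \<forall>s\<in>{0..T}. \<forall>t\<in>{0..T}.
       \<bar>b t \<omega> - b s \<omega>\<bar> \<le> W n \<omega> + 2 * real (Suc n) * S \<omega> * \<bar>t - s\<bar>"
proof -
  \<comment> \<open>The random variable \<open>W n\<close> is the modulus of continuity of \<open>b\<close> at distance \<open>1 / Suc n\<close>,
    written as a supremum over a compact set of pairs of times.\<close>
  define I where "I n = {0..T} \<times> {0..T} \<inter> {p. \<bar>snd p - fst p\<bar> \<le> 1 / real (Suc n)}" for n
  have I: "compact (I n)" "(0, 0) \<in> I n" for n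
    unfolding I_def using T
    by (auto intro!: compact_Int_closed compact_Times closed_Collect_le continuous_intros)
  have "\<exists>W. W \<in> borel_measurable M \<and> (AE \<omega> in M. (\<forall>p\<in>I n. \<bar>b (snd p) \<omega> - b (fst p) \<omega>\<bar> \<le> W \<omega>) \<and>
      (\<exists>p\<in>I n. W \<omega> = \<bar>b (snd p) \<omega> - b (fst p) \<omega>\<bar>))" for n
  proof -
    have "AE \<omega> in M. continuous_on (I n) (\<lambda>p. b (snd p) \<omega> - b (fst p) \<omega>)"
      using cont
    proof eventually_elim
      case (elim \<omega>)
      show ?case
        by (intro continuous_on_diff continuous_on_compose2[OF elim, of "I n" snd]
            continuous_on_compose2[OF elim, of "I n" fst] continuous_on_fst continuous_on_snd continuous_on_id)
          (auto simp: I_def)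
    qed
    moreover have "(\<lambda>\<omega>. b (snd p) \<omega> - b (fst p) \<omega>) \<in> borel_measurable M" if "p \<in> I n" for p
      using that by (auto simp: I_def intro!: borel_measurable_diff meas)
    ultimately show ?thesis
      using path_sup[of "I n" "\<lambda>p \<omega>. b (snd p) \<omega> - b (fst p) \<omega>" M] I[of n] by blast
  qed
  then obtain W where W: "\<And>n. W n \<in> borel_measurable M"
    "\<And>n. AE \<omega> in M. (\<forall>p\<in>I n. \<bar>b (snd p) \<omega> - b (fst p) \<omega>\<bar> \<le> W n \<omega>) \<and>
      (\<exists>p\<in>I n. W n \<omega> = \<bar>b (snd p) \<omega> - b (fst p) \<omega>\<bar>)"
    using choice[of "\<lambda>n W. W \<in> borel_measurable M \<and> (AE \<omega> in M. (\<forall>p\<in>I n. \<bar>b (snd p) \<omega> - b (fst p) \<omega>\<bar> \<le> W \<omega>) \<and>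
      (\<exists>p\<in>I n. W \<omega> = \<bar>b (snd p) \<omega> - b (fst p) \<omega>\<bar>))"] by blast
  have WS: "AE \<omega> in M. \<bar>W n \<omega>\<bar> \<le> 2 * S \<omega>" for n
    using W(2)[of n] S(2)
  proof eventually_elim
    case (elim \<omega>)
    then obtain p where p: "p \<in> I n" "W n \<omega> = \<bar>b (snd p) \<omega> - b (fst p) \<omega>\<bar>" by auto
    then have "\<bar>b (snd p) \<omega>\<bar> \<le> S \<omega>" "\<bar>b (fst p) \<omega>\<bar> \<le> S \<omega>" using elim by (auto simp: I_def)
    then show ?case using p by linarith
  qed
  have L2: "L2 M (W n)" for n
    by (rule L2_bound[OF L2_cmult[OF S(1)] W(1) WS])
  have "(\<lambda>n. \<integral>\<omega>. (W n \<omega>)\<^sup>2 \<partial>M) \<longlonglongrightarrow> (\<integral>\<omega>. 0 \<partial>M)"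
  proof (rule integral_dominated_convergence[where w = "\<lambda>\<omega>. (2 * S \<omega>)\<^sup>2"])
    show "AE \<omega> in M. norm ((W n \<omega>)\<^sup>2) \<le> (2 * S \<omega>)\<^sup>2" for n
      using WS[of n]
    proof eventually_elim
      case (elim \<omega>)
      then show ?case using power_mono[OF elim abs_ge_zero, of 2] by simp
    qed
    have "AE \<omega> in M. \<forall>n. \<exists>p\<in>I n. W n \<omega> = \<bar>b (snd p) \<omega> - b (fst p) \<omega>\<bar>"
      unfolding AE_all_countable using W(2) by (auto elim!: eventually_mono)
    then show "AE \<omega> in M. (\<lambda>n. (W n \<omega>)\<^sup>2) \<longlonglongrightarrow> 0"
      using cont
    proof eventually_elim
      case (elim \<omega>)
      have uc: "uniformly_continuous_on {0..T} (\<lambda>t. b t \<omega>)"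
        using elim by (intro compact_uniformly_continuous) auto
      have "(\<lambda>n. W n \<omega>) \<longlonglongrightarrow> 0"
      proof (rule LIMSEQ_I)
        fix e :: real assume "0 < e"
        then obtain d where d: "0 < d" "\<And>s t. s \<in> {0..T} \<Longrightarrow> t \<in> {0..T} \<Longrightarrow> \<bar>t - s\<bar> < d \<Longrightarrow>
            \<bar>b t \<omega> - b s \<omega>\<bar> < e"
          using uc unfolding uniformly_continuous_on_def dist_real_def by metis
        obtain N where N: "1 / real (Suc N) < d" using nat_approx_posE[OF d(1)] by metis
        have "norm (W n \<omega> - 0) < e" if "n \<ge> N" for n
        proof -
          obtain p where p: "p \<in> I n" "W n \<omega> = \<bar>b (snd p) \<omega> - b (fst p) \<omega>\<bar>"
            using elim(1) by blast
          have "1 / real (Suc n) \<le> 1 / real (Suc N)" using that by (simp add: frac_le)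
          then show ?thesis using p d(2)[of "fst p" "snd p"] N by (auto simp: I_def)
        qed
        then show "\<exists>N. \<forall>n\<ge>N. norm (W n \<omega> - 0) < e" by blast
      qed
      then show ?case by (auto intro!: tendsto_eq_intros)
    qed
  qed (use L2_square[OF S(1)] W(1) in \<open>auto simp: power_mult_distrib\<close>)
  moreover have "AE \<omega> in M. \<forall>s\<in>{0..T}. \<forall>t\<in>{0..T}.
       \<bar>b t \<omega> - b s \<omega>\<bar> \<le> W n \<omega> + 2 * real (Suc n) * S \<omega> * \<bar>t - s\<bar>" for n
    using W(2)[of n] S(2) WS[of n]
  proof eventually_elim
    case (elim \<omega>)
    have S0: "0 \<le> S \<omega>" using elim(3) by linarith
    show ?case
    proof (intro ballI)
      fix s t assume st: "s \<in> {0..T}" "t \<in> {0..T}"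
      show "\<bar>b t \<omega> - b s \<omega>\<bar> \<le> W n \<omega> + 2 * real (Suc n) * S \<omega> * \<bar>t - s\<bar>"
      proof (cases "(s, t) \<in> I n")
        case True
        then have "\<bar>b t \<omega> - b s \<omega>\<bar> \<le> W n \<omega>" using elim(1) by force
        also have "\<dots> \<le> W n \<omega> + 2 * real (Suc n) * S \<omega> * \<bar>t - s\<bar>" using S0 by simp
        finally show ?thesis .
      next
        case False
        \<comment> \<open>Times further apart than \<open>1 / Suc n\<close>: the crude bound \<open>2 * S\<close> is absorbed by the
          linear term.\<close>
        then have "1 \<le> real (Suc n) * \<bar>t - s\<bar>" using st by (auto simp: I_def field_simps)
        then have "2 * S \<omega> * 1 \<le> 2 * S \<omega> * (real (Suc n) * \<bar>t - s\<bar>)"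
          using S0 by (intro mult_left_mono) auto
        moreover have "\<bar>b t \<omega> - b s \<omega>\<bar> \<le> 2 * S \<omega>"
          using elim(2) st by (smt (verit))
        moreover have "0 \<le> W n \<omega>" using elim(1) by force
        ultimately show ?thesis by (simp add: algebra_simps)
      qed
    qed
  qed
  ultimately show thesis using that[of W] L2 by simp
qed

section \<open>The coupling in mean square\<close>

lemma measurable_noise_filtration:
  assumes B: "brownian_motion P B" and \<Phi>: "\<Phi> \<in> borel_measurable P"
    and X: "X \<in> borel_measurable (noise_filtration P \<Phi> B t)"
  shows "X \<in> borel_measurable P"
proof -
  let ?G = "{\<Phi> -` A \<inter> space P | A. A \<in> sets borel}
      \<union> (\<Union>s\<in>{0..t}. {B s -` A \<inter> space P | A. A \<in> sets borel}) \<union> null_sets P"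
  have G: "?G \<subseteq> sets P"
    using B \<Phi> by (auto simp: brownian_motion_def intro: measurable_sets null_setsD2)
  then have "?G \<subseteq> Pow (space P)"
    using sets.space_closed by (rule order_trans)
  then have "sets (noise_filtration P \<Phi> B t) \<subseteq> sets P"
    unfolding noise_filtration_def
    using G by (simp only: sets_measure_of sets.sigma_sets_subset)
  moreover have "space (noise_filtration P \<Phi> B t) = space P"
    by (simp add: noise_filtration_def space_measure_of_conv)
  ultimately show ?thesis
    using X by (auto simp: measurable_def)
qed

lemma SUP_square_le:
  fixes f :: "real \<Rightarrow> real"
  assumes "\<And>t. t \<in> I \<Longrightarrow> \<bar>f t\<bar> \<le> c"
  shows "(SUP t\<in>I. ennreal (\<bar>f t\<bar>\<^sup>2)) \<le> ennreal (c\<^sup>2)"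
  using assms by (intro SUP_least ennreal_leI power_mono) auto

text \<open>The pathwise estimate is applied with \<open>S\<close> and \<open>A\<close> equal to the weighted supremum \<open>Z\<close> and its
expectation, and \<open>second_moment_self_bound\<close> then eliminates \<open>Z\<close>. On the right only quantities
of the first-order system, the noise and the initial velocity remain, whose moments do not depend
on \<open>\<beta>\<close>.\<close>

lemma (in prob_space) coupling_L2:
  fixes x v y b :: "real \<Rightarrow> 'a \<Rightarrow> real" and \<xi> \<eta> :: "'a \<Rightarrow> real" and K :: "real \<Rightarrow> real"
  assumes \<kappa>: "0 < \<kappa>" and \<beta>: "8 * \<kappa> \<le> \<beta>" and T: "0 \<le> T"
    and K: "\<kappa>-lipschitz_on UNIV K" "\<And>z. \<bar>K z\<bar> \<le> \<kappa> * \<bar>z\<bar>"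
    and meas: "\<And>t. t \<in> {0..T} \<Longrightarrow> x t \<in> borel_measurable M"
      "\<And>t. t \<in> {0..T} \<Longrightarrow> y t \<in> borel_measurable M"
    and cont: "AE \<omega> in M. continuous_on {0..T} (\<lambda>t. x t \<omega>)"
      "AE \<omega> in M. continuous_on {0..T} (\<lambda>t. v t \<omega>)"
      "AE \<omega> in M. continuous_on {0..T} (\<lambda>t. y t \<omega>)"
    and Sx: "L2 M Sx" "AE \<omega> in M. \<forall>t\<in>{0..T}. \<bar>x t \<omega>\<bar> \<le> Sx \<omega>"
    and Sy: "L2 M Sy" "AE \<omega> in M. \<forall>t\<in>{0..T}. \<bar>y t \<omega>\<bar> \<le> Sy \<omega>"
    and b0: "AE \<omega> in M. b 0 \<omega> = 0"
    and xv: "AE \<omega> in M. \<forall>t\<in>{0..T}. x t \<omega> = \<xi> \<omega> + integral {0..t} (\<lambda>s. v s \<omega>) \<and>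
       v t \<omega> = \<eta> \<omega> + integral {0..t} (\<lambda>s. - \<beta> * v s \<omega> + \<beta> * K (x s \<omega> - expectation (x s)))
         + \<beta> * b t \<omega>"
    and y: "AE \<omega> in M. \<forall>t\<in>{0..T}.
       y t \<omega> = \<xi> \<omega> + integral {0..t} (\<lambda>s. K (y s \<omega> - expectation (y s))) + b t \<omega>"
    and L2: "L2 M \<eta>" "L2 M W" "L2 M C" "\<And>\<omega>. 0 \<le> C \<omega>"
    and W: "AE \<omega> in M. \<forall>s\<in>{0..T}. \<forall>t\<in>{0..T}. \<bar>b t \<omega> - b s \<omega>\<bar> \<le> W \<omega> + C \<omega> * \<bar>t - s\<bar>"
  shows "(\<integral>\<^sup>+\<omega>. (SUP t\<in>{0..T}. ennreal (\<bar>x t \<omega> - y t \<omega>\<bar>\<^sup>2)) \<partial>M) \<le>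
    ennreal (exp (16 * \<kappa> * T) * 5 *
      expectation (\<lambda>\<omega>. (W \<omega> + (2 * \<bar>\<eta> \<omega>\<bar> + C \<omega> + \<kappa> * (Sy \<omega> + expectation Sy)) / \<beta>)\<^sup>2))"
proof -
  \<comment> \<open>With this rate, \<open>\<kappa> / \<rho> + \<kappa> / \<beta> \<le> 1 / 4\<close>, so the self-interaction term of the pathwise estimate
    can be absorbed.\<close>
  define \<rho> where "\<rho> = 8 * \<kappa>"
  have pos: "0 < \<beta>" "0 < \<rho>" using \<kappa> \<beta> by (auto simp: \<rho>_def)
  define R where "R \<omega> = W \<omega> + (2 * \<bar>\<eta> \<omega>\<bar> + C \<omega> + \<kappa> * (Sy \<omega> + expectation Sy)) / \<beta>" for \<omega>
  have R: "L2 M R"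
    unfolding R_def divide_inverse mult.commute[of _ "inverse \<beta>"]
    by (intro L2_add L2_cmult L2_abs L2_const L2 Sy)
  obtain Z where Z: "Z \<in> borel_measurable M" "\<And>\<omega>. 0 \<le> Z \<omega>"
    "AE \<omega> in M. (\<forall>t\<in>{0..T}. \<bar>exp (- \<rho> * t) * (x t \<omega> - y t \<omega>)\<bar> \<le> Z \<omega>) \<and>
      (\<exists>t\<in>{0..T}. Z \<omega> = \<bar>exp (- \<rho> * t) * (x t \<omega> - y t \<omega>)\<bar>)"
  proof (rule path_sup[of "{0..T}" "\<lambda>t \<omega>. exp (- \<rho> * t) * (x t \<omega> - y t \<omega>)" M])
    show "AE \<omega> in M. continuous_on {0..T} (\<lambda>t. exp (- \<rho> * t) * (x t \<omega> - y t \<omega>))"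
      using cont(1,3) by eventually_elim (intro continuous_intros)
  qed (use T meas in auto)
  have ZS: "AE \<omega> in M. \<bar>Z \<omega>\<bar> \<le> Sx \<omega> + Sy \<omega>"
    using Z(3) Sx(2) Sy(2)
  proof eventually_elim
    case (elim \<omega>)
    then obtain t where t: "t \<in> {0..T}" "Z \<omega> = exp (- \<rho> * t) * \<bar>x t \<omega> - y t \<omega>\<bar>"
      by (auto simp: abs_mult)
    have "exp (- \<rho> * t) * \<bar>x t \<omega> - y t \<omega>\<bar> \<le> 1 * \<bar>x t \<omega> - y t \<omega>\<bar>"
      using t pos by (intro mult_right_mono) auto
    then have "Z \<omega> \<le> \<bar>x t \<omega> - y t \<omega>\<bar>" using t(2) by simp
    moreover have "\<bar>x t \<omega>\<bar> \<le> Sx \<omega>" "\<bar>y t \<omega>\<bar> \<le> Sy \<omega>" using elim t by auto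
    ultimately show ?case using Z(2)[of \<omega>] by linarith
  qed
  have L2Z: "L2 M Z" by (rule L2_bound[OF L2_add[OF Sx(1) Sy(1)] Z(1) ZS])
  have bound: "AE \<omega> in M. \<forall>t\<in>{0..T}. \<bar>x t \<omega> - y t \<omega>\<bar> \<le> exp (\<rho> * t) * Z \<omega>"
    using Z(3) by eventually_elim (auto simp: abs_mult exp_minus field_simps)
  have int: "integrable M (x t)" "integrable M (y t)" if "t \<in> {0..T}" for t
    by (rule L2_integrable[OF L2_bound[OF Sx(1) meas(1)[OF that]]],
        use Sx(2) that in \<open>auto elim: eventually_mono\<close>)
      (rule L2_integrable[OF L2_bound[OF Sy(1) meas(2)[OF that]]],
        use Sy(2) that in \<open>auto elim: eventually_mono\<close>)
  \<comment> \<open>The means are deterministic, so their distance is controlled by the expectation of the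
    same weighted supremum that controls the paths.\<close>
  have A: "\<bar>expectation (x t) - expectation (y t)\<bar> \<le> exp (\<rho> * t) * expectation Z"
    if "t \<in> {0..T}" for t
  proof -
    have "\<bar>expectation (x t) - expectation (y t)\<bar> = \<bar>expectation (\<lambda>\<omega>. x t \<omega> - y t \<omega>)\<bar>"
      using int that by simp
    also have "\<dots> \<le> expectation (\<lambda>\<omega>. \<bar>x t \<omega> - y t \<omega>\<bar>)" by (rule integral_abs_bound)
    also have "\<dots> \<le> expectation (\<lambda>\<omega>. exp (\<rho> * t) * Z \<omega>)"
      using int[OF that] L2_integrable[OF L2Z] bound that
      by (intro integral_mono_AE) (auto elim: eventually_mono)
    finally show ?thesis by simp
  qed
  have Ey: "\<bar>expectation (y t)\<bar> \<le> expectation Sy" if "t \<in> {0..T}" for t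
  proof (rule abs_expectation_le[OF Sy(1) meas(2)[OF that]])
    show "AE \<omega> in M. \<bar>y t \<omega>\<bar> \<le> Sy \<omega>"
      using Sy(2) by eventually_elim (use that in auto)
  qed
  \<comment> \<open>Continuity of the means makes the drift terms integrable in time, so that the integrals in
    the equations can be split.\<close>
  have c\<mu>: "continuous_on {0..T} (\<lambda>t. expectation (x t))"
    by (rule continuous_on_expectation[OF meas(1) cont(1) L2_integrable[OF Sx(1)] Sx(2)])
  have c\<nu>: "continuous_on {0..T} (\<lambda>t. expectation (y t))"
    by (rule continuous_on_expectation[OF meas(2) cont(3) L2_integrable[OF Sy(1)] Sy(2)])
  have "AE \<omega> in M. Z \<omega> \<le> (Z \<omega> + expectation Z) / 4 + R \<omega>"
    using Z(3) bound cont Sy(2) b0 xv y W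
  proof eventually_elim
    case (elim \<omega>)
    obtain t where t: "t \<in> {0..T}" "Z \<omega> = exp (- \<rho> * t) * \<bar>x t \<omega> - y t \<omega>\<bar>"
      using elim(1) by (auto simp: abs_mult)
    have Y: "\<bar>y s \<omega> - expectation (y s)\<bar> \<le> Sy \<omega> + expectation Sy" if "s \<in> {0..T}" for s
      using Ey[OF that] elim(6) that by (smt (verit, best))
    have path: "\<bar>x t \<omega> - y t \<omega>\<bar> \<le> exp (\<rho> * t) * ((\<kappa> / \<rho> + \<kappa> / \<beta>) * (Z \<omega> + expectation Z)) + W \<omega>
      + (2 * \<bar>\<eta> \<omega>\<bar> + C \<omega> + \<kappa> * (Sy \<omega> + expectation Sy)) / \<beta>"
      by (rule coupling_pathwise[where x = "\<lambda>t. x t \<omega>" and v = "\<lambda>t. v t \<omega>" and y = "\<lambda>t. y t \<omega>"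
            and b = "\<lambda>t. b t \<omega>" and \<mu> = "\<lambda>t. expectation (x t)" and \<nu> = "\<lambda>t. expectation (y t)"
            and K = K and \<xi> = "\<xi> \<omega>" and T = T])
        (use \<kappa> pos K elim c\<mu> c\<nu> A Y L2(4) t(1) in auto)
    have cancel: "exp (- \<rho> * t) * exp (\<rho> * t) = 1" by (simp flip: exp_add)
    have EZ: "0 \<le> Z \<omega> + expectation Z" using Z(2) by (simp add: integral_nonneg_AE)
    have "exp (- \<rho> * t) * \<bar>x t \<omega> - y t \<omega>\<bar> \<le> exp (- \<rho> * t) *
        (exp (\<rho> * t) * ((\<kappa> / \<rho> + \<kappa> / \<beta>) * (Z \<omega> + expectation Z)) + R \<omega>)"
      using path by (intro mult_left_mono) (auto simp: R_def)
    also have "\<dots> = (\<kappa> / \<rho> + \<kappa> / \<beta>) * (Z \<omega> + expectation Z) + exp (- \<rho> * t) * R \<omega>"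
      unfolding distrib_left mult.assoc[symmetric] cancel by simp
    also have "\<dots> \<le> (1 / 4) * (Z \<omega> + expectation Z) + 1 * R \<omega>"
    proof (intro add_mono mult_right_mono EZ)
      show "\<kappa> / \<rho> + \<kappa> / \<beta> \<le> 1 / 4" using \<kappa> \<beta> pos(1) by (simp add: \<rho>_def field_simps)
      show "exp (- \<rho> * t) \<le> 1" using pos t by simp
      have "0 \<le> W \<omega>" using bspec[OF bspec[OF elim(10), of 0], of 0] T by simp
      moreover have "0 \<le> Sy \<omega> + expectation Sy" using Y[OF t(1)] by linarith
      ultimately show "0 \<le> R \<omega>" unfolding R_def using \<kappa> pos L2(4)[of \<omega>] by simp
    qed
    finally show ?case using t(2) by simp
  qed
  note EZ = second_moment_self_bound[OF L2Z R Z(2) this]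
  have "(\<integral>\<^sup>+\<omega>. (SUP t\<in>{0..T}. ennreal (\<bar>x t \<omega> - y t \<omega>\<bar>\<^sup>2)) \<partial>M) \<le>
      (\<integral>\<^sup>+\<omega>. ennreal ((exp (\<rho> * T) * Z \<omega>)\<^sup>2) \<partial>M)"
    using bound
  proof (intro nn_integral_mono_AE, eventually_elim)
    case (elim \<omega>)
    show ?case
    proof (rule SUP_square_le)
      fix t assume t: "t \<in> {0..T}"
      then have "exp (\<rho> * t) * Z \<omega> \<le> exp (\<rho> * T) * Z \<omega>"
        using pos Z(2) by (intro mult_right_mono) auto
      then show "\<bar>x t \<omega> - y t \<omega>\<bar> \<le> exp (\<rho> * T) * Z \<omega>" using elim t by force
    qed
  qed
  also have "\<dots> = ennreal (expectation (\<lambda>\<omega>. (exp (\<rho> * T) * Z \<omega>)\<^sup>2))"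
    using L2_square[OF L2_cmult[OF L2Z]] by (intro nn_integral_eq_integral) auto
  also have "expectation (\<lambda>\<omega>. (exp (\<rho> * T) * Z \<omega>)\<^sup>2) = exp (16 * \<kappa> * T) * expectation (\<lambda>\<omega>. (Z \<omega>)\<^sup>2)"
    by (simp add: power_mult_distrib \<rho>_def flip: exp_double)
  also have "\<dots> \<le> exp (16 * \<kappa> * T) * 5 * expectation (\<lambda>\<omega>. (R \<omega>)\<^sup>2)"
    using EZ by (simp add: mult.assoc)
  finally show ?thesis by (simp add: R_def ennreal_leI)
qed

theorem theorem1:
  fixes P :: "'a measure"
    and K :: "real \<Rightarrow> real" and \<kappa> M :: real
    and B :: "real \<Rightarrow> 'a \<Rightarrow> real" and \<Phi> :: "'a \<Rightarrow> real \<times> real"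
    and x v :: "real \<Rightarrow> real \<Rightarrow> 'a \<Rightarrow> real" and y :: "real \<Rightarrow> 'a \<Rightarrow> real"
    and T :: real
  assumes "prob_space P"
    and "\<kappa> > 0"
    and "\<kappa>-lipschitz_on UNIV K"
    and "\<And>a b. \<bar>K (a - b)\<bar> \<le> \<kappa> * \<bar>a - b\<bar>"
    and "brownian_motion P B"
    and "\<Phi> \<in> borel_measurable P"
    and "indep_of_process P \<Phi> B"
    and "(\<integral>\<^sup>+\<omega>. ennreal ((norm (\<Phi> \<omega>))\<^sup>2) \<partial>P) < ennreal M"
    and "\<And>\<beta>. \<beta> > 0 \<Longrightarrow> second_order_solution P K B \<Phi> \<beta> (x \<beta>) (v \<beta>)"
    and "first_order_solution P K B \<Phi> y"
  shows "((\<lambda>\<beta>. \<integral>\<^sup>+\<omega>. (SUP t\<in>{0..T}. ennreal (\<bar>x \<beta> t \<omega> - y t \<omega>\<bar>\<^sup>2)) \<partial>P) \<longlongrightarrow> 0) at_top"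
proof (cases "0 \<le> T")
  case False
  then show ?thesis by (simp add: bot_ennreal)
next
  case T: True
  interpret prob_space P by fact
  note \<kappa> = assms(2) and lip = assms(3) and BM = assms(5) and \<Phi> = assms(6) and fin\<Phi> = assms(8)
  have K: "\<bar>K z\<bar> \<le> \<kappa> * \<bar>z\<bar>" for z
    using assms(4)[of z 0] by simp
  have contK: "continuous_on UNIV K" by (rule lipschitz_on_continuous_on[OF lip])
  note meas = measurable_noise_filtration[OF BM \<Phi>]

  have "integrable P (\<lambda>\<omega>. (norm (\<Phi> \<omega>))\<^sup>2)"
    using fin\<Phi> \<Phi> by (intro integrableI_bounded) (auto intro: less_trans)
  then have L2\<Phi>: "L2 P (\<lambda>\<omega>. norm (\<Phi> \<omega>))"
    using \<Phi> by (simp add: L2_def)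
  have L2x0: "L2 P (\<lambda>\<omega>. fst (\<Phi> \<omega>))" and L2v0: "L2 P (\<lambda>\<omega>. snd (\<Phi> \<omega>))"
    using \<Phi> by (auto intro!: L2_bound[OF L2\<Phi>] measurable_compose[OF \<Phi>] borel_measurable_continuous_onI
        continuous_intros simp: norm_prod_def)

  have y_meas: "y t \<in> borel_measurable P" if "t \<in> {0..T}" for t
    using assms(10) that meas unfolding first_order_solution_def continuous_adapted_def by auto
  have cont_Icc: "AE \<omega> in P. continuous_on {0..T} (\<lambda>t. X t \<omega>)"
    if "AE \<omega> in P. continuous_on {0..} (\<lambda>t. X t \<omega>)" for X :: "real \<Rightarrow> 'a \<Rightarrow> real"
    using that by eventually_elim (auto elim: continuous_on_subset)
  have y_cont: "AE \<omega> in P. continuous_on {0..T} (\<lambda>t. y t \<omega>)"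
    using assms(10) by (intro cont_Icc) (simp add: first_order_solution_def continuous_adapted_def)
  have y_eq: "AE \<omega> in P. \<forall>t\<in>{0..T}. y t \<omega> = fst (\<Phi> \<omega>)
      + integral {0..t} (\<lambda>s. K (y s \<omega> - expectation (y s))) + B t \<omega>"
    using assms(10) unfolding first_order_solution_def by (auto elim!: eventually_mono)
  obtain Sy where Sy: "L2 P Sy" "AE \<omega> in P. \<forall>t\<in>{0..T}. \<bar>y t \<omega>\<bar> \<le> Sy \<omega>"
    using second_moment_path_sup[of T y P] T y_meas y_cont assms(10)
    unfolding first_order_solution_def by blast
  have \<nu>_cont: "continuous_on {0..T} (\<lambda>t. expectation (y t))"
    by (rule continuous_on_expectation[OF y_meas y_cont L2_integrable[OF Sy(1)] Sy(2)])
  have Ey: "\<bar>expectation (y t)\<bar> \<le> expectation Sy" if "t \<in> {0..T}" for t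
  proof (rule abs_expectation_le[OF Sy(1) y_meas[OF that]])
    show "AE \<omega> in P. \<bar>y t \<omega>\<bar> \<le> Sy \<omega>"
      using Sy(2) by eventually_elim (use that in auto)
  qed

  have B_meas: "B t \<in> borel_measurable P" if "t \<in> {0..T}" for t
    using BM that by (auto simp: brownian_motion_def)
  have B_cont: "AE \<omega> in P. continuous_on {0..T} (\<lambda>t. B t \<omega>)"
    using BM by (intro cont_Icc) (simp add: brownian_motion_def)
  have B0: "AE \<omega> in P. B 0 \<omega> = 0" using BM by (simp add: brownian_motion_def)
  \<comment> \<open>The first-order equation, solved for the noise, dominates \<open>\<bar>B t\<bar>\<close> on \<open>{0..T}\<close> by a
    square-integrable variable.\<close>
  define S where "S \<omega> = \<bar>Sy \<omega> + \<bar>fst (\<Phi> \<omega>)\<bar> + \<kappa> * T * (Sy \<omega> + expectation Sy)\<bar>" for \<omega>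
  have L2S: "L2 P S"
    unfolding S_def by (intro L2_add L2_cmult L2_abs L2_const Sy L2x0)
  have B_le: "AE \<omega> in P. \<forall>t\<in>{0..T}. \<bar>B t \<omega>\<bar> \<le> S \<omega>"
    using y_cont y_eq Sy(2)
  proof eventually_elim
    case (elim \<omega>)
    show ?case
    proof
      fix t assume t: "t \<in> {0..T}"
      have "\<bar>B t \<omega>\<bar> \<le> Sy \<omega> + \<bar>fst (\<Phi> \<omega>)\<bar> + \<kappa> * T * (Sy \<omega> + expectation Sy)"
        by (rule noise_path_bound[OF \<kappa> K contK elim(1) \<nu>_cont _ Ey _ t]) (use elim in auto)
      then show "\<bar>B t \<omega>\<bar> \<le> S \<omega>" by (simp add: S_def)
    qed
  qed
  obtain W :: "nat \<Rightarrow> 'a \<Rightarrow> real" where W: "\<And>n. L2 P (W n)"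
    "(\<lambda>n. \<integral>\<omega>. (W n \<omega>)\<^sup>2 \<partial>P) \<longlonglongrightarrow> 0"
    "\<And>n. AE \<omega> in P. \<forall>s\<in>{0..T}. \<forall>t\<in>{0..T}.
       \<bar>B t \<omega> - B s \<omega>\<bar> \<le> W n \<omega> + 2 * real (Suc n) * S \<omega> * \<bar>t - s\<bar>"
    using modulus_of_continuity_L2[OF T B_meas B_cont L2S B_le] by blast

  define H where "H n \<omega> = 2 * \<bar>snd (\<Phi> \<omega>)\<bar> + 2 * real (Suc n) * S \<omega> + \<kappa> * (Sy \<omega> + expectation Sy)" for n \<omega>
  have L2H: "L2 P (H n)" for n
    unfolding H_def by (intro L2_add L2_cmult L2_abs L2_const Sy L2S L2v0)
  define c where "c = exp (16 * \<kappa> * T) * 5"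
  define I where "I \<beta> = (\<integral>\<^sup>+\<omega>. (SUP t\<in>{0..T}. ennreal (\<bar>x \<beta> t \<omega> - y t \<omega>\<bar>\<^sup>2)) \<partial>P)" for \<beta>
  define E where "E n \<beta> = c * (2 * expectation (\<lambda>\<omega>. (W n \<omega>)\<^sup>2) +
      2 * expectation (\<lambda>\<omega>. (H n \<omega>)\<^sup>2) * (inverse \<beta>)\<^sup>2)" for n \<beta>
  have I_le: "I \<beta> \<le> ennreal (E n \<beta>)" if \<beta>: "8 * \<kappa> \<le> \<beta>" for n \<beta>
  proof -
    have \<beta>0: "0 < \<beta>" using \<beta> \<kappa> by linarith
    note sol = assms(9)[OF \<beta>0, unfolded second_order_solution_def continuous_adapted_def]
    have x_meas: "x \<beta> t \<in> borel_measurable P" if "t \<in> {0..T}" for t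
      using sol that meas by auto
    have x_cont: "AE \<omega> in P. continuous_on {0..T} (\<lambda>t. x \<beta> t \<omega>)"
      and v_cont: "AE \<omega> in P. continuous_on {0..T} (\<lambda>t. v \<beta> t \<omega>)"
      using sol by (blast intro: cont_Icc)+
    have "(\<integral>\<^sup>+\<omega>. (SUP t\<in>{0..T}. ennreal (\<bar>x \<beta> t \<omega>\<bar>\<^sup>2)) \<partial>P) \<le>
        (\<integral>\<^sup>+\<omega>. (SUP t\<in>{0..T}. ennreal (\<bar>x \<beta> t \<omega>\<bar>\<^sup>2 + \<bar>v \<beta> t \<omega>\<bar>\<^sup>2)) \<partial>P)"
      by (intro nn_integral_mono SUP_mono') (auto intro!: ennreal_leI)
    also have "\<dots> < \<infinity>" using sol by blast
    finally obtain Sx where Sx: "L2 P Sx" "AE \<omega> in P. \<forall>t\<in>{0..T}. \<bar>x \<beta> t \<omega>\<bar> \<le> Sx \<omega>"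
      using second_moment_path_sup[of T "x \<beta>" P] T x_meas x_cont by blast
    have xv_eq: "AE \<omega> in P. \<forall>t\<in>{0..T}. x \<beta> t \<omega> = fst (\<Phi> \<omega>) + integral {0..t} (\<lambda>s. v \<beta> s \<omega>) \<and>
       v \<beta> t \<omega> = snd (\<Phi> \<omega>)
         + integral {0..t} (\<lambda>s. - \<beta> * v \<beta> s \<omega> + \<beta> * K (x \<beta> s \<omega> - expectation (x \<beta> s)))
         + \<beta> * B t \<omega>"
      using conjunct2[OF conjunct2[OF conjunct2[OF sol]]] by eventually_elim auto
    have "I \<beta> \<le> ennreal (c * expectation (\<lambda>\<omega>. (W n \<omega> + H n \<omega> / \<beta>)\<^sup>2))"
      unfolding I_def c_def H_def
      by (rule coupling_L2[where x = "x \<beta>" and v = "v \<beta>" and C = "\<lambda>\<omega>. 2 * real (Suc n) * S \<omega>",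
            OF \<kappa> \<beta> T lip K x_meas y_meas x_cont v_cont y_cont Sx Sy B0 xv_eq y_eq L2v0 W(1)
              L2_cmult[OF L2S] _ W(3)])
        (simp_all add: S_def)
    also have "c * expectation (\<lambda>\<omega>. (W n \<omega> + H n \<omega> / \<beta>)\<^sup>2) \<le> E n \<beta>"
    proof -
      have "expectation (\<lambda>\<omega>. (W n \<omega> + H n \<omega> / \<beta>)\<^sup>2) \<le>
          expectation (\<lambda>\<omega>. 2 * (W n \<omega>)\<^sup>2 + 2 * (H n \<omega>)\<^sup>2 * (inverse \<beta>)\<^sup>2)"
      proof (rule integral_mono)
        show "integrable P (\<lambda>\<omega>. (W n \<omega> + H n \<omega> / \<beta>)\<^sup>2)"
          using L2_square[OF L2_add[OF W(1)[of n] L2_cmult[OF L2H[of n], of "inverse \<beta>"]]]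
          by (simp add: divide_inverse mult.commute)
        show "(W n \<omega> + H n \<omega> / \<beta>)\<^sup>2 \<le> 2 * (W n \<omega>)\<^sup>2 + 2 * (H n \<omega>)\<^sup>2 * (inverse \<beta>)\<^sup>2" for \<omega>
          using sum_squared_le[of "W n \<omega>" "H n \<omega> / \<beta>"] by (simp add: divide_inverse power_mult_distrib)
      qed (use L2_square[OF W(1)] L2_square[OF L2H] in auto)
      also have "\<dots> = 2 * expectation (\<lambda>\<omega>. (W n \<omega>)\<^sup>2) +
          2 * expectation (\<lambda>\<omega>. (H n \<omega>)\<^sup>2) * (inverse \<beta>)\<^sup>2"
        using L2_square[OF W(1)] L2_square[OF L2H] by simp
      finally show ?thesis unfolding E_def by (intro mult_left_mono) (auto simp: c_def)
    qed
    finally show ?thesis by (simp add: ennreal_leI)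
  qed

  have "(I \<longlongrightarrow> 0) at_top"
  proof (rule order_tendstoI)
    fix a :: ennreal assume "0 < a"
    then obtain z where z: "0 < z" "z < a" using dense by blast
    then obtain e where e: "z = ennreal e" "0 < e" by (cases z) auto
    have "(\<lambda>n. c * (2 * expectation (\<lambda>\<omega>. (W n \<omega>)\<^sup>2))) \<longlonglongrightarrow> c * (2 * 0)"
      by (intro tendsto_intros W(2))
    then have "eventually (\<lambda>n. c * (2 * expectation (\<lambda>\<omega>. (W n \<omega>)\<^sup>2)) < e) sequentially"
      using e by (intro order_tendstoD(2)) auto
    \<comment> \<open>The scale \<open>1 / Suc n\<close> of the modulus is fixed before \<open>\<beta>\<close> grows, since \<open>H n\<close> grows with \<open>n\<close>.\<close>
    then obtain n where n: "c * (2 * expectation (\<lambda>\<omega>. (W n \<omega>)\<^sup>2)) < e"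
      by (auto simp: eventually_sequentially)
    have "((\<lambda>\<beta>. E n \<beta>) \<longlongrightarrow> c * (2 * expectation (\<lambda>\<omega>. (W n \<omega>)\<^sup>2) +
        2 * expectation (\<lambda>\<omega>. (H n \<omega>)\<^sup>2) * 0\<^sup>2)) at_top"
      unfolding E_def by (intro tendsto_intros tendsto_inverse_0_at_top filterlim_ident)
    then have "eventually (\<lambda>\<beta>. E n \<beta> < e) at_top"
      using n by (intro order_tendstoD(2)) auto
    then show "eventually (\<lambda>\<beta>. I \<beta> < a) at_top"
      using eventually_ge_at_top[of "8 * \<kappa>"]
    proof eventually_elim
      case (elim \<beta>)
      have "I \<beta> \<le> ennreal (E n \<beta>)" by (rule I_le[OF elim(2)])
      also have "\<dots> \<le> ennreal e" using elim(1) by (intro ennreal_leI) simp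
      finally show ?case using z e by simp
    qed
  qed simp
  then show ?thesis unfolding I_def .
qed

end
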